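(* Assume that $\mathrm{et}(\mathbb{C}^2)\ne\mathrm{Aut}(\mathbb{C}^2)$. Then: 1) $\mathrm{et}_p(\mathbb{C}^2)\ne\emptyset$. 2) For every $F\in\mathrm{et}(\mathbb{C}^2)$ there exist $k\in\mathbb{Z}^+\cup\{0\}$, $A_0\in\mathrm{Aut}(\mathbb{C}^2)$ and $P_1,\ldots,P_k\in\mathrm{et}_p(\mathbb{C}^2)$ such that $F=A_0\circ P_1\circ\cdots\circ P_k$.
   Context: $\mathrm{et}(\mathbb{C}^2)$ denotes the set of all polynomial mappings $G=(G_1,G_2)\in\mathbb{C}[X,Y]^2$ such that (1) $\det J_G\equiv 1$, where $J_G$ is the Jacobian matrix of $G$, and (2) $\deg G_1=\deg_Y G_1$ and $\deg G_2=\deg_Y G_2$. With composition $\circ$ as binary operation, $(\mathrm{et}(\mathbb{C}^2),\circ)$ is taken to be a semigroup with unit $\mathrm{id}$; it contains the group $\mathrm{Aut}(\mathbb{C}^2)$ of all invertible polynomial mappings (subject to conditions (1) and (2)). A mapping $F\in\mathrm{et}(\mathbb{C}^2)$ is composite if there are $G,H\in\mathrm{et}(\mathbb{C}^2)-\mathrm{Aut}(\mathbb{C}^2)$ with $F=G\circ H$; a mapping in $\mathrm{et}(\mathbb{C}^2)-\mathrm{Aut}(\mathbb{C}^2)$ is prime if it is not composite. $\mathrm{et}_p(\mathbb{C}^2)$ is the set of prime mappings. *)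

theory Defs
  imports "HOL-Analysis.Determinants" "HOL-Computational_Algebra.Polynomial"
begin

text \<open>
  Bivariate polynomials over the complex numbers are elements of $C[X][Y]$: the outer
  indeterminate is $Y$ and the coefficients are polynomials in $X$.  Thus the coefficient of
  $X^i Y^j$ in \<open>p\<close> is \<open>coeff (coeff p j) i\<close>, and \<open>degree p\<close> is the degree of \<open>p\<close> in $Y$.
\<close>

type_synonym bpoly = "complex poly poly"

type_synonym polymap = "bpoly \<times> bpoly"

definition varX :: bpoly where
  "varX = [:[:0, 1:]:]"

definition varY :: bpoly where
  "varY = [:0, 1:]"

definition bconst :: "complex \<Rightarrow> bpoly" where
  "bconst a = [:[:a:]:]"

text \<open>The inserted 0 only serves to make the total degree of the zero polynomial 0.\<close>

definition total_degree :: "bpoly \<Rightarrow> nat" where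
  "total_degree p = Max (insert 0 {i + j | i j. coeff (coeff p j) i \<noteq> 0})"

abbreviation degree_Y :: "bpoly \<Rightarrow> nat" where
  "degree_Y p \<equiv> degree p"

definition deriv_X :: "bpoly \<Rightarrow> bpoly" where
  "deriv_X p = map_poly pderiv p"

definition deriv_Y :: "bpoly \<Rightarrow> bpoly" where
  "deriv_Y p = pderiv p"

definition jacobian :: "polymap \<Rightarrow> bpoly ^ 2 ^ 2" where
  "jacobian G = vector [vector [deriv_X (fst G), deriv_Y (fst G)],
                        vector [deriv_X (snd G), deriv_Y (snd G)]]"

text \<open>\<open>bsubst p H\<close> is the polynomial $p(H_1, H_2)$.\<close>

definition bsubst :: "bpoly \<Rightarrow> polymap \<Rightarrow> bpoly" where
  "bsubst p H = poly (map_poly (\<lambda>c. poly (map_poly bconst c) (fst H)) p) (snd H)"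

definition pm_comp :: "polymap \<Rightarrow> polymap \<Rightarrow> polymap" (infixl "\<circ>\<^sub>2" 70) where
  "G \<circ>\<^sub>2 H = (bsubst (fst G) H, bsubst (snd G) H)"

definition pm_id :: polymap where
  "pm_id = (varX, varY)"

definition pm_invertible :: "polymap \<Rightarrow> bool" where
  "pm_invertible F \<longleftrightarrow> (\<exists>G. F \<circ>\<^sub>2 G = pm_id \<and> G \<circ>\<^sub>2 F = pm_id)"

definition et :: "polymap set" where
  "et = {G. det (jacobian G) = 1
          \<and> total_degree (fst G) = degree_Y (fst G)
          \<and> total_degree (snd G) = degree_Y (snd G)}"

text \<open>
  Conditions (1) and (2) are imposed on the invertible map itself, not on its inverse.
  Taken literally, the degree condition excludes \<open>pm_id\<close> (the first component $X$ has degree 1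
  but degree 0 in $Y$) and is not preserved by all compositions.  No definition
  below relies on \<open>pm_id \<in> et\<close> or on closure of \<open>et\<close> under composition.
\<close>

definition Aut :: "polymap set" where
  "Aut = {F \<in> et. pm_invertible F}"

definition composite :: "polymap \<Rightarrow> bool" where
  "composite F \<longleftrightarrow> F \<in> et \<and> (\<exists>G \<in> et - Aut. \<exists>H \<in> et - Aut. F = G \<circ>\<^sub>2 H)"

definition et_p :: "polymap set" where
  "et_p = {F \<in> et - Aut. \<not> composite F}"

lemma finite_support_bpoly: "finite {i + j | i j. coeff (coeff p j) i \<noteq> 0}"
  for p :: bpoly
proof -
  have "{i + j | i j. coeff (coeff p j) i \<noteq> 0}
        \<subseteq> (\<Union>j \<in> {..degree p}. (\<lambda>i. i + j) ` {..degree (coeff p j)})"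
    by (force intro: le_degree)
  then show ?thesis
    by (rule finite_subset) auto
qed

lemma poly_map_bconst:
  "poly (poly (poly (map_poly bconst c) q) [:y:]) x = poly c (poly (poly q [:y:]) x)"
proof (induction c)
  case (pCons a c)
  have "map_poly bconst (pCons a c) = pCons (bconst a) (map_poly bconst c)"
    using pCons.hyps by (simp add: map_poly_pCons bconst_def)
  moreover have "poly (poly (bconst a) [:y:]) x = a"
    by (simp add: bconst_def)
  ultimately show ?case
    using pCons.IH by simp
qed simp

lemma poly_bsubst:
  "poly (poly (bsubst p H) [:y:]) x
   = poly (poly p [:poly (poly (snd H) [:y:]) x:]) (poly (poly (fst H) [:y:]) x)"
proof (induction p)
  case (pCons a p)
  have "bsubst (pCons a p) H = poly (map_poly bconst a) (fst H) + snd H * bsubst p H"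
    using pCons.hyps by (simp add: bsubst_def map_poly_pCons)
  then show ?case
    using pCons.IH by (simp add: poly_map_bconst)
qed (simp add: bsubst_def)

end

theory Submission
  imports Defs
    "HOL-Computational_Algebra.Polynomial_Factorial"
    "HOL-Computational_Algebra.Field_as_Ring"
    "HOL-Computational_Algebra.Fundamental_Theorem_Algebra"
begin

text \<open>
  Factorizations terminate because of a numerical invariant, the geometric degree of a map.  It is
  multiplicative under composition, and for a Keller map (Jacobian determinant 1) it equals 1 only
  if the map is invertible; so a proper factor of \<open>F\<close> has smaller degree than \<open>F\<close>.

  The invariant is used here in the form \<open>generic_rank\<close>: the largest number of polynomials in
  \<open>X, Y\<close> that are linearly independent over the polynomials in the components of \<open>F\<close>.  It is finite
  by a dimension count (\<open>independent_over_card_le\<close>), and products of independent families show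
  that it is supermultiplicative (\<open>generic_rank_comp\<close>).  If the rank of a Keller map \<open>F\<close> is 1,
  then \<open>X\<close> and \<open>Y\<close> are fractions of polynomials in \<open>F\<close>.  The point is that such fractions have no denominators
  (\<open>Keller_fraction_is_polynomial\<close>): a prime \<open>r\<close> that divides both the numerator and the
  denominator of a reduced fraction after substitution of \<open>F\<close> would define a curve contracted by
  \<open>F\<close> to a point, and then \<open>r\<close> would divide the Jacobian determinant.  Hence \<open>F\<close> has a polynomial
  inverse (\<open>Keller_noninvertible_generic_rank\<close>).

  The second difficulty is the degree condition in \<open>et\<close>, which the identity violates and which
  compositions need not inherit.  It says that the leading forms do not vanish at \<open>(0, 1)\<close>, and so
  it can be restored by linear changes of coordinates.  The shears \<open>(X + t Y, Y)\<close> suffice: for all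
  but finitely many \<open>t\<close>, precomposition with a shear puts any Keller map into \<open>et\<close>, and
  postcomposition with the inverse shear keeps an element of \<open>et\<close> there (\<open>ex_shear_regularizing\<close>).
  Inserting a generic shear and its inverse between two factors therefore repairs a factorization
  whose left factor violates the degree condition, and a prime stays prime under a shear that
  keeps it in \<open>et\<close> (\<open>prime_shear_comp\<close>).

  With these tools, induction on the rank shows that every noninvertible element of \<open>et\<close> has a
  prime right factor with cofactor in \<open>et\<close> (\<open>ex_prime_right_factor\<close>).  Splitting off such
  factors lowers the rank until an invertible map remains.
\<close>

section \<open>Substitution as a ring homomorphism\<close>

abbreviation beval :: "bpoly \<Rightarrow> complex \<Rightarrow> complex \<Rightarrow> complex" where
  "beval p x y \<equiv> poly (poly p [:y:]) x"

text \<open>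
  Over an infinite field a polynomial is determined by its values, so that every identity
  between substitutions can be checked pointwise with \<open>poly_bsubst\<close>.
\<close>

lemma bpoly_eqI:
  fixes p q :: bpoly
  assumes "\<And>x y. beval p x y = beval q x y"
  shows "p = q"
proof (rule ccontr)
  assume "p \<noteq> q"
  then have "finite {z. poly (p - q) z = 0}"
    by (intro poly_roots_finite) simp
  moreover have "range (\<lambda>y::complex. [:y:]) \<subseteq> {z. poly (p - q) z = 0}"
    using assms by (auto simp flip: poly_eq_poly_eq_iff)
  ultimately have "finite (range (\<lambda>y::complex. [:y:]))"
    by (rule rev_finite_subset)
  moreover have "inj (\<lambda>y::complex. [:y:])"
    by (auto intro: injI)
  ultimately show False
    using infinite_UNIV_char_0 finite_imageD by blast
qed

lemma beval_base [simp]: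
  "beval (bconst c) x y = c" "beval varX x y = x" "beval varY x y = y"
  by (simp_all add: bconst_def varX_def varY_def)

lemma bsubst_base [simp]:
  "bsubst (bconst c) H = bconst c" "bsubst varX H = fst H" "bsubst varY H = snd H"
  by (rule bpoly_eqI; simp add: poly_bsubst)+

lemma bsubst_hom [simp]:
  "bsubst 0 H = 0" "bsubst 1 H = 1"
  "bsubst (p + q) H = bsubst p H + bsubst q H"
  "bsubst (p - q) H = bsubst p H - bsubst q H"
  "bsubst (- p) H = - bsubst p H"
  "bsubst (p * q) H = bsubst p H * bsubst q H"
  by (rule bpoly_eqI; simp add: poly_bsubst)+

lemma bsubst_power [simp]: "bsubst (p ^ n) H = bsubst p H ^ n"
  by (induction n) simp_all

lemma bsubst_sum [simp]: "bsubst (sum f A) H = (\<Sum>a\<in>A. bsubst (f a) H)"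
  by (induction A rule: infinite_finite_induct) simp_all

lemma bsubst_bsubst: "bsubst (bsubst p G) H = bsubst p (G \<circ>\<^sub>2 H)"
  by (rule bpoly_eqI) (simp add: poly_bsubst pm_comp_def)

lemma bsubst_id [simp]: "bsubst p pm_id = p"
  by (rule bpoly_eqI) (simp add: poly_bsubst pm_id_def)

lemma pm_comp_assoc: "(F \<circ>\<^sub>2 G) \<circ>\<^sub>2 H = F \<circ>\<^sub>2 (G \<circ>\<^sub>2 H)"
  by (simp add: pm_comp_def[of F] pm_comp_def[of "(_, _)"] bsubst_bsubst)

lemma pm_comp_id [simp]: "F \<circ>\<^sub>2 pm_id = F" "pm_id \<circ>\<^sub>2 F = F"
  by (simp_all add: pm_comp_def) (simp add: pm_id_def)

lemma pm_invertible_comp: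
  assumes "pm_invertible F" "pm_invertible G"
  shows "pm_invertible (F \<circ>\<^sub>2 G)"
proof -
  obtain F' G' where *: "F \<circ>\<^sub>2 F' = pm_id" "F' \<circ>\<^sub>2 F = pm_id" "G \<circ>\<^sub>2 G' = pm_id" "G' \<circ>\<^sub>2 G = pm_id"
    using assms by (auto simp: pm_invertible_def)
  have "(F \<circ>\<^sub>2 G) \<circ>\<^sub>2 (G' \<circ>\<^sub>2 F') = F \<circ>\<^sub>2 (G \<circ>\<^sub>2 G') \<circ>\<^sub>2 F'"
    "(G' \<circ>\<^sub>2 F') \<circ>\<^sub>2 (F \<circ>\<^sub>2 G) = G' \<circ>\<^sub>2 (F' \<circ>\<^sub>2 F) \<circ>\<^sub>2 G"
    by (simp_all only: pm_comp_assoc)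
  then show ?thesis
    unfolding pm_invertible_def using * by (metis pm_comp_id)
qed

lemma bsubst_const_poly: "bsubst [:c:] H = poly (map_poly bconst c) (fst H)"
  by (simp add: bsubst_def map_poly_pCons)

lemma bpoly_induct [case_names const X Y add mult]:
  assumes "\<And>c. P (bconst c)" "P varX" "P varY"
    and "\<And>p q. P p \<Longrightarrow> P q \<Longrightarrow> P (p + q)"
    and "\<And>p q. P p \<Longrightarrow> P q \<Longrightarrow> P (p * q)"
  shows "P p"
proof (induction p)
  case 0
  show ?case using assms(1)[of 0] by (simp add: bconst_def)
next
  case (pCons c p)
  have "P [:c:]"
  proof (induction c)
    case 0
    show ?case using assms(1)[of 0] by (simp add: bconst_def)
  next
    case (pCons a c)
    have "[:pCons a c:] = bconst a + varX * [:c:]"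
      by (simp add: bconst_def varX_def)
    moreover have "P (bconst a + varX * [:c:])"
      using pCons by (intro assms)
    ultimately show ?case by (simp only:)
  qed
  then have "P ([:c:] + varY * p)"
    using pCons by (intro assms)
  moreover have "pCons c p = [:c:] + varY * p"
    by (simp add: varY_def)
  ultimately show ?case by (simp only:)
qed

section \<open>Derivations and Keller maps\<close>

lemma beval_deriv_X: "beval (deriv_X p) x y = poly (pderiv (poly p [:y:])) x"
proof (induction p)
  case (pCons a p)
  then show ?case
    by (simp add: deriv_X_def map_poly_pCons pderiv_add pderiv_smult pderiv_pCons)
qed (simp add: deriv_X_def)

lemma bconst_simps [simp]: "bconst 0 = 0" "bconst 1 = 1" "bconst a = 0 \<longleftrightarrow> a = 0"
  by (simp_all add: bconst_def one_pCons)

lemma bconst_arith: "bconst a + bconst b = bconst (a + b)" "bconst a * bconst b = bconst (a * b)"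
  "bconst a - bconst b = bconst (a - b)" "- bconst a = bconst (- a)"
  by (simp_all add: bconst_def)

lemma deriv_base [simp]:
  "deriv_X (bconst c) = 0" "deriv_X varX = 1" "deriv_X varY = 0"
  "deriv_Y (bconst c) = 0" "deriv_Y varX = 0" "deriv_Y varY = 1"
  by (simp_all add: deriv_X_def deriv_Y_def bconst_def varX_def varY_def map_poly_pCons
      pderiv_pCons one_pCons)

text \<open>
  The chain rule uses of a partial derivative only that it is a derivation over the complex
  numbers.  Stating it for any derivation avoids proving it once for \<open>X\<close> and once for \<open>Y\<close>.
\<close>

locale bpoly_derivation =
  fixes D :: "bpoly \<Rightarrow> bpoly"
  assumes D_add: "D (p + q) = D p + D q"
    and D_mult: "D (p * q) = p * D q + q * D p"
    and D_const [simp]: "D (bconst c) = 0"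
begin

lemma D_diff_const: "D (p - bconst c) = D p"
  using D_add[of "p - bconst c" "bconst c"] by simp

end

interpretation deriv_X: bpoly_derivation deriv_X
proof
  show "deriv_X (p + q) = deriv_X p + deriv_X q" for p q
    by (rule bpoly_eqI) (simp add: beval_deriv_X pderiv_add)
  show "deriv_X (p * q) = p * deriv_X q + q * deriv_X p" for p q
    by (rule bpoly_eqI) (simp add: beval_deriv_X pderiv_mult)
qed simp

interpretation deriv_Y: bpoly_derivation deriv_Y
  by standard (simp_all add: deriv_Y_def pderiv_add pderiv_mult bconst_def pderiv_pCons)

lemma (in bpoly_derivation) D_bsubst:
  "D (bsubst p H) = bsubst (deriv_X p) H * D (fst H) + bsubst (deriv_Y p) H * D (snd H)"
  by (induction p rule: bpoly_induct)
    (simp_all add: D_add D_mult deriv_X.D_add deriv_X.D_mult deriv_Y.D_add deriv_Y.D_mult algebra_simps)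

definition jac :: "polymap \<Rightarrow> bpoly" where
  "jac F = deriv_X (fst F) * deriv_Y (snd F) - deriv_Y (fst F) * deriv_X (snd F)"

lemma det_jacobian: "det (jacobian F) = jac F"
  by (simp add: jacobian_def jac_def det_2)

lemma jac_comp: "jac (G \<circ>\<^sub>2 H) = bsubst (jac G) H * jac H"
  by (simp add: jac_def pm_comp_def deriv_X.D_bsubst deriv_Y.D_bsubst algebra_simps)

abbreviation Keller :: "polymap \<Rightarrow> bool" where
  "Keller F \<equiv> jac F = 1"

lemma Keller_comp: "Keller G \<Longrightarrow> Keller H \<Longrightarrow> Keller (G \<circ>\<^sub>2 H)"
  by (simp add: jac_comp)

text \<open>
  By the chain rule the row vector of the two substituted partial derivatives is annihilated by
  the Jacobian matrix of \<open>F\<close>, and this matrix is invertible; the proof multiplies by its adjugate.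
\<close>

lemma gradient_zero_imp:
  assumes F: "Keller F" and p: "bsubst p F = 0"
  shows "bsubst (deriv_X p) F = 0" "bsubst (deriv_Y p) F = 0"
proof -
  define u v where "u = bsubst (deriv_X p) F" and "v = bsubst (deriv_Y p) F"
  have 1: "u * deriv_X (fst F) + v * deriv_X (snd F) = 0"
    using deriv_X.D_bsubst[of p F] p deriv_X.D_const[of 0] by (simp add: u_def v_def)
  have 2: "u * deriv_Y (fst F) + v * deriv_Y (snd F) = 0"
    using deriv_Y.D_bsubst[of p F] p deriv_Y.D_const[of 0] by (simp add: u_def v_def)
  have "u * jac F = (u * deriv_X (fst F) + v * deriv_X (snd F)) * deriv_Y (snd F)
      - (u * deriv_Y (fst F) + v * deriv_Y (snd F)) * deriv_X (snd F)"
    unfolding jac_def by (simp add: algebra_simps)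
  then have "u = 0"
    unfolding F 1 2 by simp
  then show "bsubst (deriv_X p) F = 0"
    unfolding u_def .
  have "v * jac F = (u * deriv_Y (fst F) + v * deriv_Y (snd F)) * deriv_X (fst F)
      - (u * deriv_X (fst F) + v * deriv_X (snd F)) * deriv_Y (fst F)"
    unfolding jac_def by (simp add: algebra_simps)
  then have "v = 0"
    unfolding F 1 2 by simp
  then show "bsubst (deriv_Y p) F = 0"
    unfolding v_def .
qed

text \<open>
  A relation of minimal degree between the components would have partial derivatives that are
  again relations, of smaller degree, hence zero.  The degree in \<open>Y\<close> is reduced to 0 first, and
  then the degree in \<open>X\<close>.
\<close>

lemma Keller_algebraically_independent:
  assumes F: "Keller F" and "bsubst p F = 0"
  shows "p = 0"
  using assms(2)
proof (induction "degree p" arbitrary: p rule: less_induct)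
  case (less p)
  have const: "c = 0" if "bsubst [:c:] F = 0" for c :: "complex poly"
    using that
  proof (induction "degree c" arbitrary: c rule: less_induct)
    case (less c)
    have "deriv_X [:c:] = [:pderiv c:]"
      by (simp add: deriv_X_def map_poly_pCons)
    then have c': "bsubst [:pderiv c:] F = 0"
      using gradient_zero_imp(1)[OF F less.prems] by simp
    have "degree c = 0"
    proof (rule ccontr)
      assume "degree c \<noteq> 0"
      then have "pderiv c = 0"
        using less.hyps[OF _ c'] by (simp add: degree_pderiv)
      with \<open>degree c \<noteq> 0\<close> show False
        by (simp add: pderiv_eq_0_iff)
    qed
    then obtain a where "c = [:a:]"
      by (rule degree_eq_zeroE)
    moreover have "[:c:] = bconst a"
      by (simp add: \<open>c = [:a:]\<close> bconst_def)
    ultimately show "c = 0"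
      using less.prems by simp
  qed
  have p': "bsubst (pderiv p) F = 0"
    using gradient_zero_imp(2)[OF F less.prems] by (simp add: deriv_Y_def)
  have "degree p = 0"
  proof (rule ccontr)
    assume "degree p \<noteq> 0"
    then have "pderiv p = 0"
      using less.hyps[OF _ p'] by (simp add: degree_pderiv)
    with \<open>degree p \<noteq> 0\<close> show False
      by (simp add: pderiv_eq_0_iff)
  qed
  then obtain c where "p = [:c:]"
    by (rule degree_eq_zeroE)
  with const less.prems show "p = 0"
    by simp
qed

lemma Keller_bsubst_eq_iff: "Keller F \<Longrightarrow> bsubst p F = bsubst q F \<longleftrightarrow> p = q"
  using Keller_algebraically_independent[of F "p - q"] by auto

text \<open>
  Since the components of \<open>F\<close> are algebraically independent, \<open>F\<close> can be cancelled on the right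
  in \<open>F \<circ> G \<circ> F = F\<close>.
\<close>

lemma Keller_left_inverse_imp_invertible:
  assumes "Keller F" "G \<circ>\<^sub>2 F = pm_id"
  shows "pm_invertible F"
proof -
  have "(F \<circ>\<^sub>2 G) \<circ>\<^sub>2 F = pm_id \<circ>\<^sub>2 F"
    by (simp add: pm_comp_assoc assms)
  then have "bsubst (fst (F \<circ>\<^sub>2 G)) F = bsubst (fst pm_id) F"
    "bsubst (snd (F \<circ>\<^sub>2 G)) F = bsubst (snd pm_id) F"
    unfolding pm_comp_def[of _ F] by (metis prod.inject)+
  then have "F \<circ>\<^sub>2 G = pm_id"
    using assms(1) by (simp add: Keller_bsubst_eq_iff prod_eq_iff)
  with assms(2) show ?thesis
    unfolding pm_invertible_def by blast
qed

section \<open>Fractions of polynomials in a Keller map\<close>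

text \<open>
  The polynomial \<open>c\<close> splits into linear factors over the complex numbers, and \<open>r\<close> divides the
  value at \<open>z\<close> of one of them.
\<close>

lemma prime_dvd_split_poly:
  fixes c :: "complex poly" and r z :: bpoly
  assumes r: "prime_elem r" and "c \<noteq> 0" "r dvd poly (map_poly bconst c) z"
  shows "\<exists>a. r dvd z - bconst a"
  using assms(2,3)
proof (induction "degree c" arbitrary: c rule: less_induct)
  case (less c)
  show ?case
  proof (cases "degree c = 0")
    case True
    then obtain a where c: "c = [:a:]"
      by (rule degree_eq_zeroE)
    with less.prems have "r dvd bconst a" "a \<noteq> 0"
      by (simp_all add: map_poly_pCons bconst_def)
    moreover have "bconst a * bconst (1 / a) = 1"
      using \<open>a \<noteq> 0\<close> by (simp add: bconst_arith)
    ultimately have "r dvd 1"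
      by (metis dvd_mult2)
    with r show ?thesis
      by (simp add: prime_elem_def)
  next
    case False
    then obtain a where "poly c a = 0"
      using fundamental_theorem_of_algebra[of c] by (auto simp: constant_degree)
    then obtain c' where c: "c = [:- a, 1:] * c'"
      by (auto simp: poly_eq_0_iff_dvd elim: dvdE)
    have "poly (map_poly bconst c) z = (z - bconst a) * poly (map_poly bconst c') z"
    proof (rule bpoly_eqI)
      fix x y
      have ev: "beval (poly (map_poly bconst d) z) x y = poly d (beval z x y)" for d
        by (rule poly_map_bconst)
      show "beval (poly (map_poly bconst c) z) x y
          = beval ((z - bconst a) * poly (map_poly bconst c') z) x y"
        by (simp add: ev c algebra_simps)
    qed
    with less.prems r have "r dvd z - bconst a \<or> r dvd poly (map_poly bconst c') z"
      by (simp add: prime_elem_dvd_mult_iff)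
    moreover have "c' \<noteq> 0"
      using c less.prems(1) by auto
    moreover have "degree c' < degree c"
      using degree_mult_eq[of "[:- a, 1:]" c'] \<open>c' \<noteq> 0\<close> unfolding c
      by (simp del: mult_pCons_left)
    ultimately show ?thesis
      using less.hyps by blast
  qed
qed

text \<open>
  Gauss's lemma: contents are multiplicative, so the scalar \<open>a\<close> divides the content of the
  complementary factor.
\<close>

lemma primitive_dvd_smult_cancel:
  fixes m f :: bpoly
  assumes "content m = 1" "a \<noteq> 0" "m dvd smult a f"
  shows "m dvd f"
proof -
  obtain g where g: "smult a f = m * g"
    using assms(3) by (auto elim: dvdE)
  have "content (smult a f) = content m * content g"
    unfolding g by (rule content_mult)
  then have "a dvd content g"
    using assms(1) by (metis content_smult dvd_mult2 dvd_normalize_iff dvd_refl mult_1)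
  then obtain h where "g = smult a h"
    by (metis const_poly_dvd_iff_dvd_content dvdE mult_pCons_left pCons_0_0 add_0_right mult_zero_left)
  with g have "smult a f = smult a (m * h)"
    by simp
  with \<open>a \<noteq> 0\<close> show ?thesis
    by (metis dvd_triv_left smult_cancel)
qed

text \<open>
  The polynomials \<open>f\<close> for which \<open>r\<close> divides \<open>f(F)\<close> form a prime ideal.  If it contained no
  nonzero polynomial in \<open>X\<close> alone, it would be generated, up to factors in \<open>X\<close>, by an element of
  least degree in \<open>Y\<close>.  The primitive part of that element lies in the ideal as well and divides
  the coprime polynomials \<open>p\<close> and \<open>q\<close>, so it would be a unit, and so would \<open>r\<close>.
\<close>

lemma coprime_prime_divisor_contains_univariate:
  assumes r: "prime_elem r" and cop: "coprime p q"
    and "r dvd bsubst p F" "r dvd bsubst q F"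
  shows "\<exists>c. c \<noteq> 0 \<and> r dvd bsubst [:c:] F"
proof (rule ccontr)
  assume no: "\<not> ?thesis"
  define I where "I = {f. f \<noteq> 0 \<and> r dvd bsubst f F}"
  have "p \<noteq> 0 \<or> q \<noteq> 0"
    using cop by auto
  then obtain m0 where "m0 \<in> I"
    using assms(3,4) unfolding I_def by blast
  then obtain m where m: "m \<in> I" and min: "\<And>f. f \<in> I \<Longrightarrow> degree m \<le> degree f"
    using ex_has_least_nat[of "\<lambda>f. f \<in> I" m0 degree] by blast
  define m' where "m' = primitive_part m"
  have "m \<noteq> 0"
    using m by (simp add: I_def)
  have m': "content m' = 1" "degree m' = degree m" "m' \<noteq> 0"
    using \<open>m \<noteq> 0\<close> by (simp_all add: m'_def)
  have "[:content m:] * m' = m"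
    by (simp add: m'_def)
  then have "bsubst m F = bsubst [:content m:] F * bsubst m' F"
    using bsubst_hom(6)[of "[:content m:]" m' F] by (simp only:)
  moreover have "r dvd bsubst m F"
    using m by (simp add: I_def)
  ultimately have "r dvd bsubst [:content m:] F \<or> r dvd bsubst m' F"
    by (simp only: prime_elem_dvd_mult_iff[OF r])
  moreover have "content m \<noteq> 0"
    using \<open>m \<noteq> 0\<close> by simp
  ultimately have "r dvd bsubst m' F"
    using no by blast
  have dvd: "m' dvd f" if "r dvd bsubst f F" for f
  proof -
    obtain a g where ag: "a \<noteq> 0" "smult a f = m' * g + pseudo_mod f m'"
      using pseudo_mod(1)[OF \<open>m' \<noteq> 0\<close>, of f] by blast
    have "pseudo_mod f m' = [:a:] * f - m' * g"
      using ag by simp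
    then have "bsubst (pseudo_mod f m') F = bsubst [:a:] F * bsubst f F - bsubst m' F * bsubst g F"
      by (simp only: bsubst_hom)
    then have "r dvd bsubst (pseudo_mod f m') F"
      using that \<open>r dvd bsubst m' F\<close> by simp
    then have "pseudo_mod f m' = 0 \<or> degree m' \<le> degree (pseudo_mod f m')"
      unfolding m'(2) using min unfolding I_def by blast
    then have "pseudo_mod f m' = 0"
      using pseudo_mod(2)[OF \<open>m' \<noteq> 0\<close>, of f] leD by blast
    with ag(2) have "smult a f = m' * g"
      by (simp only: add_0_right)
    then have "m' dvd smult a f"
      by (rule dvdI)
    with m'(1) ag(1) show ?thesis
      by (rule primitive_dvd_smult_cancel)
  qed
  have "is_unit m'"
    using cop dvd assms(3,4) coprime_common_divisor by blast
  then obtain n where n: "m' * n = 1"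
    by (metis dvdE)
  have "bsubst m' F * bsubst n F = 1"
    using bsubst_hom(6)[of m' n F] by (simp only: n bsubst_hom(2))
  with \<open>r dvd bsubst m' F\<close> have "r dvd 1"
    by (metis dvd_mult2)
  with r show False
    by (simp add: prime_elem_def)
qed

text \<open>
  A prime ideal with two coprime elements contains the ideal of a point: two plane curves
  without a common component meet in finitely many points.
\<close>

lemma coprime_prime_divisor_imp_point:
  assumes r: "prime_elem r" and cop: "coprime p q"
    and pq: "r dvd bsubst p F" "r dvd bsubst q F"
  shows "\<exists>a b. r dvd fst F - bconst a \<and> r dvd snd F - bconst b"
proof -
  obtain c where "c \<noteq> 0" "r dvd bsubst [:c:] F"
    using coprime_prime_divisor_contains_univariate[OF assms] by blast
  then obtain a where a: "r dvd fst F - bconst a"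
    using prime_dvd_split_poly[OF r, of c] by (auto simp: bsubst_const_poly)
  \<comment> \<open>Modulo \<open>r\<close> the first component of \<open>F\<close> is the constant \<open>a\<close>, so \<open>f(F)\<close> is congruent to
    \<open>s f\<close> evaluated at the second component, where \<open>s f\<close> is \<open>f\<close> restricted to the line \<open>X = a\<close>.\<close>
  define s :: "bpoly \<Rightarrow> complex poly" where "s f = map_poly (\<lambda>c. poly c a) f" for f
  have lin: "[:[:- a, 1:]:] = varX - bconst a"
    by (simp add: varX_def bconst_def)
  have s: "r dvd poly (map_poly bconst (s f)) (snd F)" if "r dvd bsubst f F" for f
  proof -
    have ev: "poly (s f) y = beval f a y" for y
      unfolding s_def by (induction f) (simp_all add: map_poly_pCons)
    define g :: bpoly where "g = f - poly (map_poly bconst (s f)) varY"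
    have evg: "beval g x y = beval f x y - beval f a y" for x y
      by (simp add: g_def poly_map_bconst ev)
    have "g = map_poly (\<lambda>c. c - [:poly c a:]) f"
    proof (rule bpoly_eqI)
      show "beval g x y = beval (map_poly (\<lambda>c. c - [:poly c a:]) f) x y" for x y
        unfolding evg by (induction f) (simp_all add: map_poly_pCons algebra_simps)
    qed
    moreover have "[:- a, 1:] dvd c - [:poly c a:]" for c
      by (simp flip: poly_eq_0_iff_dvd)
    ultimately have "[:[:- a, 1:]:] dvd g"
      by (simp add: const_poly_dvd_iff coeff_map_poly)
    then obtain h where "g = (varX - bconst a) * h"
      unfolding lin by (auto elim: dvdE)
    then have "bsubst g F = (fst F - bconst a) * bsubst h F"
      by simp
    with a have "r dvd bsubst g F"
      by simp
    moreover have "bsubst g F = bsubst f F - poly (map_poly bconst (s f)) (snd F)"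
      unfolding g_def by (simp, rule bpoly_eqI) (simp add: poly_bsubst poly_map_bconst)
    ultimately show ?thesis
      using that by (metis diff_diff_eq2 add_diff_cancel_left' dvd_diff)
  qed
  \<comment> \<open>Otherwise \<open>X - a\<close> would be a common factor of \<open>p\<close> and \<open>q\<close>.\<close>
  have "s p \<noteq> 0 \<or> s q \<noteq> 0"
  proof (rule ccontr)
    assume *: "\<not> ?thesis"
    have "[:[:- a, 1:]:] dvd f" if "s f = 0" for f
    proof -
      have "poly (coeff f n) a = 0" for n
        using that by (metis coeff_0 coeff_map_poly poly_0 s_def)
      then show ?thesis
        by (simp add: const_poly_dvd_iff poly_eq_0_iff_dvd)
    qed
    with * cop have "is_unit [:[:- a, 1:]:]"
      using coprime_common_divisor by blast
    then show False
      by (simp add: is_unit_const_poly_iff is_unit_poly_iff)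
  qed
  then obtain b where "r dvd snd F - bconst b"
    using prime_dvd_split_poly[OF r] s pq by blast
  with a show ?thesis
    by blast
qed

text \<open>
  A Keller map is a local homeomorphism and cannot contract the curve \<open>r = 0\<close> to a point.
  Algebraically: if both components are constant modulo \<open>r\<close>, their gradients are multiples of the
  gradient of \<open>r\<close> modulo \<open>r\<close>, hence parallel, and \<open>r\<close> divides the Jacobian determinant 1.
\<close>

lemma Keller_no_common_prime_divisor:
  assumes F: "Keller F" and r: "prime_elem r" and cop: "coprime p q"
  shows "\<not> (r dvd bsubst p F \<and> r dvd bsubst q F)"
proof
  assume "r dvd bsubst p F \<and> r dvd bsubst q F"
  then obtain a b where "r dvd fst F - bconst a" "r dvd snd F - bconst b"
    using coprime_prime_divisor_imp_point[OF r cop] by blast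
  then obtain u v where uv: "fst F - bconst a = r * u" "snd F - bconst b = r * v"
    by (auto elim!: dvdE)
  have D: "deriv_X (fst F) = r * deriv_X u + u * deriv_X r" "deriv_X (snd F) = r * deriv_X v + v * deriv_X r"
    "deriv_Y (fst F) = r * deriv_Y u + u * deriv_Y r" "deriv_Y (snd F) = r * deriv_Y v + v * deriv_Y r"
    using arg_cong[OF uv(1), of deriv_X] arg_cong[OF uv(2), of deriv_X]
      arg_cong[OF uv(1), of deriv_Y] arg_cong[OF uv(2), of deriv_Y]
    by (simp_all add: deriv_X.D_diff_const deriv_Y.D_diff_const deriv_X.D_mult deriv_Y.D_mult)
  have "jac F = r * (deriv_X u * (r * deriv_Y v + v * deriv_Y r) + u * deriv_X r * deriv_Y v
      - deriv_Y u * (r * deriv_X v + v * deriv_X r) - u * deriv_Y r * deriv_X v)"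
    unfolding jac_def D by (simp add: algebra_simps)
  then have "r dvd jac F"
    by (rule dvdI)
  with F r show False
    by (simp add: prime_elem_def)
qed

lemma is_unit_bpolyE:
  fixes q :: bpoly
  assumes "is_unit q"
  obtains c where "c \<noteq> 0" "q = bconst c"
proof -
  obtain d where d: "q = [:d:]" "is_unit d"
    using assms by (auto simp: is_unit_poly_iff)
  then obtain c where "d = [:c:]" "is_unit c"
    by (auto simp: is_unit_poly_iff)
  then show ?thesis
    using that[of c] d by (metis bconst_def not_is_unit_0)
qed

text \<open>
  A polynomial \<open>z\<close> that is a fraction \<open>p(F) / q(F)\<close> is already a polynomial in \<open>F\<close>.  In lowest
  terms, any prime factor of \<open>q(F)\<close> would also divide \<open>p(F)\<close>, which is excluded for coprime
  \<open>p\<close> and \<open>q\<close>; so \<open>q(F)\<close> is a constant.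
\<close>

lemma Keller_fraction_is_polynomial:
  assumes F: "Keller F" and "q \<noteq> 0" "bsubst q F * z = bsubst p F"
  shows "\<exists>f. z = bsubst f F"
proof -
  define g where "g = gcd p q"
  have "g \<noteq> 0"
    using \<open>q \<noteq> 0\<close> by (simp add: g_def)
  obtain p' q' where pq: "p = g * p'" "q = g * q'" "coprime p' q'"
    using gcd_coprime_exists[of p q] \<open>g \<noteq> 0\<close> unfolding g_def by (metis mult.commute)
  have "bsubst g F \<noteq> 0"
    using Keller_algebraically_independent[OF F] \<open>g \<noteq> 0\<close> by blast
  with assms(3) have z: "bsubst q' F * z = bsubst p' F"
    by (simp add: pq mult.assoc)
  have "q' \<noteq> 0"
    using \<open>q \<noteq> 0\<close> pq by auto
  have "is_unit (bsubst q' F)"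
  proof (rule ccontr)
    assume "\<not> is_unit (bsubst q' F)"
    moreover have "bsubst q' F \<noteq> 0"
      using Keller_algebraically_independent[OF F] \<open>q' \<noteq> 0\<close> by blast
    ultimately obtain r where r: "prime r" "r dvd bsubst q' F"
      using prime_divisor_exists by blast
    then have "r dvd bsubst p' F"
      by (simp flip: z)
    with r Keller_no_common_prime_divisor[OF F _ pq(3)] show False
      by blast
  qed
  then obtain c where c: "c \<noteq> 0" "bsubst q' F = bconst c"
    by (rule is_unit_bpolyE)
  have "bsubst (bconst (1 / c) * p') F = (bconst (1 / c) * bconst c) * z"
    using z c by (simp add: mult.assoc)
  also have "\<dots> = z"
    using c by (simp add: bconst_arith)
  finally show ?thesis
    by metis
qed

section \<open>Total degree and monomial expansions\<close>

lemma total_degree_le_iff: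
  "total_degree p \<le> n \<longleftrightarrow> (\<forall>i j. coeff (coeff p j) i \<noteq> 0 \<longrightarrow> i + j \<le> n)"
proof -
  have "finite (insert 0 {i + j | i j. coeff (coeff p j) i \<noteq> 0})"
    using finite_support_bpoly by simp
  then show ?thesis
    unfolding total_degree_def by (subst Max_le_iff) auto
qed

lemma le_total_degree: "coeff (coeff p j) i \<noteq> 0 \<Longrightarrow> i + j \<le> total_degree p"
  using total_degree_le_iff[of p "total_degree p"] by auto

lemma coeff_coeff_mult:
  fixes p q :: bpoly
  shows "coeff (coeff (p * q) j) i
    = (\<Sum>k\<le>j. \<Sum>l\<le>i. coeff (coeff p k) l * coeff (coeff q (j - k)) (i - l))"
  by (simp add: coeff_mult coeff_sum)

lemma total_degree_mult_le:
  assumes p: "total_degree p \<le> m" and q: "total_degree q \<le> n"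
  shows "total_degree (p * q) \<le> m + n"
  unfolding total_degree_le_iff
proof (intro allI impI)
  fix i j
  assume "coeff (coeff (p * q) j) i \<noteq> 0"
  then obtain k where "k \<le> j"
    "(\<Sum>l\<le>i. coeff (coeff p k) l * coeff (coeff q (j - k)) (i - l)) \<noteq> 0"
    unfolding coeff_coeff_mult by (meson atMost_iff sum.not_neutral_contains_not_neutral)
  then obtain l where "k \<le> j" "l \<le> i" "coeff (coeff p k) l * coeff (coeff q (j - k)) (i - l) \<noteq> 0"
    by (meson atMost_iff sum.not_neutral_contains_not_neutral)
  then have "l + k \<le> m" "i - l + (j - k) \<le> n"
    using p q unfolding total_degree_le_iff by (metis mult_eq_0_iff)+
  with \<open>k \<le> j\<close> \<open>l \<le> i\<close> show "i + j \<le> m + n"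
    by linarith
qed

lemma total_degree_bconst [simp]: "total_degree (bconst c) = 0"
proof -
  have "total_degree (bconst c) \<le> 0"
    unfolding total_degree_le_iff by (auto simp: bconst_def coeff_pCons split: nat.splits)
  then show ?thesis by simp
qed

lemma total_degree_power_le:
  assumes "total_degree p \<le> m"
  shows "total_degree (p ^ k) \<le> k * m"
proof (induction k)
  case 0
  show ?case using total_degree_bconst[of 1] by simp
next
  case (Suc k)
  then show ?case using total_degree_mult_le[OF assms Suc] by simp
qed

lemma total_degree_sum_le:
  assumes "\<And>a. a \<in> A \<Longrightarrow> total_degree (f a) \<le> n"
  shows "total_degree (sum f A) \<le> n"
  unfolding total_degree_le_iff
proof (intro allI impI)
  fix i j
  assume "coeff (coeff (sum f A) j) i \<noteq> 0"
  then have "(\<Sum>a\<in>A. coeff (coeff (f a) j) i) \<noteq> 0"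
    by (simp add: coeff_sum)
  then obtain a where "a \<in> A" "coeff (coeff (f a) j) i \<noteq> 0"
    by (meson sum.not_neutral_contains_not_neutral)
  with assms show "i + j \<le> n"
    unfolding total_degree_le_iff by blast
qed

lemma monomial_eq_monom: "bconst c * (varX ^ i * varY ^ j) = monom (monom c i) j"
proof -
  have "varX ^ i = monom (monom 1 i) 0"
    by (induction i) (simp_all add: varX_def monom_Suc monom_0 one_pCons)
  moreover have "varY ^ j = monom 1 j"
    by (induction j) (simp_all add: varY_def monom_Suc monom_0)
  moreover have "bconst c = monom (monom c 0) 0"
    by (simp add: bconst_def monom_0)
  ultimately show ?thesis
    by (simp add: mult_monom)
qed

lemma coeff_sum_monomials:
  assumes "finite S"
  shows "coeff (coeff (\<Sum>(i, j)\<in>S. bconst (c (i, j)) * (varX ^ i * varY ^ j)) j') i'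
    = (if (i', j') \<in> S then c (i', j') else 0)"
proof -
  have "coeff (coeff (\<Sum>(i, j)\<in>S. bconst (c (i, j)) * (varX ^ i * varY ^ j)) j') i'
      = (\<Sum>s\<in>S. if s = (i', j') then c s else 0)"
    by (auto simp: coeff_sum monomial_eq_monom intro!: sum.cong)
  with assms show ?thesis
    by (simp add: sum.delta)
qed

lemma bpoly_eq_sum_monomials:
  assumes "total_degree p \<le> M"
  shows "p = (\<Sum>(i, j)\<in>{..M} \<times> {..M}. bconst (coeff (coeff p j) i) * (varX ^ i * varY ^ j))"
proof (intro poly_eqI)
  fix j i
  have "coeff (coeff p j) i = 0" if "\<not> (i \<le> M \<and> j \<le> M)"
    using assms that unfolding total_degree_le_iff by (metis add_leD1 add_leD2)
  then show "coeff (coeff p j) i = coeff (coeff (\<Sum>(i, j)\<in>{..M} \<times> {..M}.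
      bconst (coeff (coeff p j) i) * (varX ^ i * varY ^ j)) j) i"
    using coeff_sum_monomials[of "{..M} \<times> {..M}" "\<lambda>(i, j). coeff (coeff p j) i"] by auto
qed

section \<open>The generic rank\<close>

lemma (in vector_space) independent_family_card_le:
  assumes I: "finite I" and T: "finite T" and span: "\<And>i. i \<in> I \<Longrightarrow> g i \<in> span T"
    and indep: "\<And>c. (\<Sum>i\<in>I. scale (c i) (g i)) = 0 \<Longrightarrow> \<forall>i\<in>I. c i = 0"
  shows "card I \<le> card T"
proof -
  have inj: "inj_on g I"
  proof (rule inj_onI, rule ccontr)
    fix i j assume ij: "i \<in> I" "j \<in> I" "g i = g j" "i \<noteq> j"
    define c where "c = (\<lambda>k. if k = i then 1 else if k = j then - 1 else 0 :: 'a)"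
    have "(\<Sum>k\<in>I. scale (c k) (g k)) = (\<Sum>k\<in>{i, j}. scale (c k) (g k))"
      using I ij by (intro sum.mono_neutral_right) (auto simp: c_def)
    also have "\<dots> = 0"
      using ij by (simp add: c_def)
    finally have "c i = 0"
      using indep ij(1) by blast
    then show False
      by (simp add: c_def)
  qed
  have "independent (g ` I)"
  proof (rule independent_if_scalars_zero)
    show "finite (g ` I)"
      using I by simp
    fix f x
    assume "(\<Sum>x\<in>g ` I. scale (f x) x) = 0" "x \<in> g ` I"
    then show "f x = 0"
      using indep[of "f \<circ> g"] by (auto simp: sum.reindex[OF inj])
  qed
  then have "card (g ` I) \<le> card T"
    using independent_span_bound[OF T] span by blast
  then show ?thesis
    by (simp add: card_image[OF inj])
qed

text \<open>
  Linear independence of \<open>r 0, ..., r (n - 1)\<close> over the subring generated by the components of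
  \<open>F\<close>.  The conclusion is about the polynomials \<open>p k\<close> and not about their values at \<open>F\<close>, so
  a family with \<open>n > 0\<close> can only be independent if the components of \<open>F\<close> are algebraically
  independent.
\<close>

definition independent_over :: "polymap \<Rightarrow> nat \<Rightarrow> (nat \<Rightarrow> bpoly) \<Rightarrow> bool" where
  "independent_over F n r \<longleftrightarrow>
    (\<forall>p. (\<Sum>k<n. bsubst (p k) F * r k) = 0 \<longrightarrow> (\<forall>k<n. p k = 0))"

text \<open>
  A dimension count.  If the components of \<open>F\<close> have degree at most \<open>D\<close> and the \<open>n\<close> members of
  the family degree at most \<open>N\<close>, then the \<open>n (N + 1)\<^sup>2\<close> products of a member with a monomial in
  \<open>F\<close> of bidegree at most \<open>(N, N)\<close> are linearly independent over the complex numbers and have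
  degree at most \<open>M = N + 2 N D\<close>.  Polynomials of that degree lie in a space of dimension at most
  \<open>(M + 1)\<^sup>2\<close>, which is at most \<open>((2 D + 1) (N + 1))\<^sup>2\<close>.
\<close>

lemma independent_over_card_le:
  assumes "independent_over F n r"
    and F: "total_degree (fst F) \<le> D" "total_degree (snd F) \<le> D"
  shows "n \<le> (2 * D + 1) ^ 2"
proof -
  interpret V: vector_space "\<lambda>c p. bconst c * p"
    by standard (simp_all add: algebra_simps flip: bconst_arith)
  define N where "N = (\<Sum>k<n. total_degree (r k))"
  have N: "total_degree (r k) \<le> N" if "k < n" for k
    unfolding N_def using that by (intro member_le_sum) auto
  define M where "M = N + (N * D + N * D)"
  define I where "I = {..<n} \<times> ({..N} \<times> {..N})"
  define g where "g = (\<lambda>(k, i, j). r k * (fst F ^ i * snd F ^ j))"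
  define T where "T = (\<lambda>(i, j). varX ^ i * varY ^ j) ` ({..M} \<times> {..M})"
  have "n * (N + 1) ^ 2 = card I"
    by (simp add: I_def power2_eq_square)
  also have "card I \<le> card T"
  proof (rule V.independent_family_card_le)
    show "finite I" "finite T"
      by (simp_all add: I_def T_def)
  next
    fix t assume "t \<in> I"
    then obtain k i j where t: "t = (k, i, j)" "k < n" "i \<le> N" "j \<le> N"
      by (auto simp: I_def)
    have "total_degree (fst F ^ i) \<le> N * D" "total_degree (snd F ^ j) \<le> N * D"
      using total_degree_power_le[OF F(1), of i] total_degree_power_le[OF F(2), of j] t
      by (meson le_trans mult_le_mono1)+
    then have "total_degree (g t) \<le> M"
      unfolding M_def g_def t by (auto intro!: total_degree_mult_le N t)
    then have "g t = (\<Sum>(i, j)\<in>{..M} \<times> {..M}.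
        bconst (coeff (coeff (g t) j) i) * (varX ^ i * varY ^ j))"
      by (rule bpoly_eq_sum_monomials)
    also have "\<dots> \<in> V.span T"
      unfolding case_prod_unfold
      by (intro V.span_sum V.span_scale V.span_base) (auto simp: T_def)
    finally show "g t \<in> V.span T" .
  next
    fix c
    assume c: "(\<Sum>t\<in>I. bconst (c t) * g t) = 0"
    define p where "p = (\<lambda>k. \<Sum>(i, j)\<in>{..N} \<times> {..N}. bconst (c (k, (i, j))) * (varX ^ i * varY ^ j))"
    have "(\<Sum>k<n. bsubst (p k) F * r k)
        = (\<Sum>k<n. \<Sum>s\<in>{..N} \<times> {..N}. bconst (c (k, s)) * g (k, s))"
      unfolding p_def g_def
      by (simp add: sum_distrib_left sum_distrib_right case_prod_unfold mult_ac del: sum.cartesian_product)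
    also have "\<dots> = (\<Sum>t\<in>I. bconst (c t) * g t)"
      unfolding I_def sum.cartesian_product by (simp add: case_prod_unfold)
    finally have "(\<Sum>k<n. bsubst (p k) F * r k) = (\<Sum>t\<in>I. bconst (c t) * g t)" .
    with c assms(1) have "\<forall>k<n. p k = 0"
      unfolding independent_over_def by metis
    show "\<forall>t\<in>I. c t = 0"
    proof
      fix t assume "t \<in> I"
      then obtain k i j where t: "t = (k, i, j)" "k < n" "i \<le> N" "j \<le> N"
        by (auto simp: I_def)
      have "coeff (coeff (p k) j) i = c t"
        using coeff_sum_monomials[of "{..N} \<times> {..N}" "\<lambda>s. c (k, s)" j i] t
        by (simp add: p_def)
      with \<open>\<forall>k<n. p k = 0\<close> t show "c t = 0"
        by auto
    qed
  qed
  also have "card T \<le> (M + 1) ^ 2"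
    unfolding T_def by (rule order.trans[OF card_image_le]) (simp_all add: power2_eq_square)
  also have "\<dots> \<le> ((2 * D + 1) * (N + 1)) ^ 2"
    by (rule power_mono) (simp_all add: M_def algebra_simps)
  finally show ?thesis
    by (simp only: power_mult_distrib) simp
qed

text \<open>
  For a Keller map \<open>F\<close> this is the rank of the polynomial ring in \<open>X, Y\<close> as a module over the
  subring generated by the components of \<open>F\<close>, that is, the degree of the corresponding extension
  of function fields, or the number of points in a generic fibre of \<open>F\<close>.
\<close>

definition generic_rank :: "polymap \<Rightarrow> nat" where
  "generic_rank F = Max {n. \<exists>r. independent_over F n r}"

lemma finite_independent_over: "finite {n. \<exists>r. independent_over F n r}"
proof (rule finite_subset)
  let ?D = "max (total_degree (fst F)) (total_degree (snd F))"
  show "{n. \<exists>r. independent_over F n r} \<subseteq> {..(2 * ?D + 1) ^ 2}"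
    using independent_over_card_le[of F _ _ ?D] by auto
qed simp

lemma generic_rank_ge: "independent_over F n r \<Longrightarrow> n \<le> generic_rank F"
  unfolding generic_rank_def using finite_independent_over by (intro Max_ge) auto

lemma generic_rank_attained: "\<exists>r. independent_over F (generic_rank F) r"
proof -
  have "independent_over F 0 r" for r
    by (simp add: independent_over_def)
  then have "{n. \<exists>r. independent_over F n r} \<noteq> {}"
    by blast
  then show ?thesis
    unfolding generic_rank_def using Max_in[OF finite_independent_over] by blast
qed

text \<open>
  As in the tower law for field degrees, if the \<open>g i\<close> are independent over \<open>G\<close> and the \<open>h j\<close>
  over \<open>H\<close>, then the products \<open>g i(H) * h j\<close> are independent over \<open>G \<circ> H\<close>: collect the terms
  of a relation with the same \<open>h j\<close>; their coefficients are polynomials in \<open>H\<close>, so they vanish.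
  The pair \<open>(i, j)\<close> is numbered \<open>i + j * m\<close>.
\<close>

lemma generic_rank_comp: "generic_rank G * generic_rank H \<le> generic_rank (G \<circ>\<^sub>2 H)"
proof -
  define m n where "m = generic_rank G" and "n = generic_rank H"
  obtain g h where g: "independent_over G m g" and h: "independent_over H n h"
    using generic_rank_attained m_def n_def by blast
  have "independent_over (G \<circ>\<^sub>2 H) (n * m) (\<lambda>k. bsubst (g (k mod m)) H * h (k div m))"
    unfolding independent_over_def
  proof (intro allI impI)
    fix p k
    assume p: "(\<Sum>k<n * m. bsubst (p k) (G \<circ>\<^sub>2 H) * (bsubst (g (k mod m)) H * h (k div m))) = 0"
      and k: "k < n * m"
    have "(\<Sum>j<n. bsubst (\<Sum>i<m. bsubst (p (i + j * m)) G * g i) H * h j)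
        = (\<Sum>j<n. \<Sum>i<m. bsubst (p (i + j * m)) (G \<circ>\<^sub>2 H) * (bsubst (g i) H * h j))"
      by (simp add: sum_distrib_right bsubst_bsubst mult.assoc)
    also have "\<dots> = (\<Sum>j<n. \<Sum>k\<in>{j * m..<j * m + m}.
        bsubst (p k) (G \<circ>\<^sub>2 H) * (bsubst (g (k mod m)) H * h (k div m)))"
    proof (rule sum.cong[OF refl])
      fix j
      let ?f = "\<lambda>k. bsubst (p k) (G \<circ>\<^sub>2 H) * (bsubst (g (k mod m)) H * h (k div m))"
      have "sum ?f {j * m..<j * m + m} = (\<Sum>i<m. ?f (i + j * m))"
        using sum.shift_bounds_nat_ivl[of ?f 0 "j * m" m]
        by (simp add: lessThan_atLeast0 add.commute)
      also have "\<dots> = (\<Sum>i<m. bsubst (p (i + j * m)) (G \<circ>\<^sub>2 H) * (bsubst (g i) H * h j))"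
        by (intro sum.cong) auto
      finally show "(\<Sum>i<m. bsubst (p (i + j * m)) (G \<circ>\<^sub>2 H) * (bsubst (g i) H * h j))
          = sum ?f {j * m..<j * m + m}" ..
    qed
    also have "\<dots> = 0"
      unfolding sum.nat_group by (rule p)
    finally have "\<forall>j<n. (\<Sum>i<m. bsubst (p (i + j * m)) G * g i) = 0"
      using h unfolding independent_over_def by fast
    then have *: "p (i + j * m) = 0" if "i < m" "j < n" for i j
      using g that unfolding independent_over_def by fast
    from k have "m \<noteq> 0"
      by (cases m) auto
    then have "k mod m < m" "k div m < n"
      using k by (simp_all add: less_mult_imp_div_less)
    from *[OF this] show "p k = 0"
      by simp
  qed
  then show ?thesis
    using generic_rank_ge by (metis m_def n_def mult.commute)
qed

lemma Keller_generic_rank_pos: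
  assumes "Keller F"
  shows "generic_rank F \<ge> 1"
proof (rule generic_rank_ge)
  show "independent_over F 1 (\<lambda>_. 1)"
    using Keller_algebraically_independent[OF assms] by (auto simp: independent_over_def)
qed

text \<open>
  If the rank is 1, every \<open>z\<close> is dependent on 1 and hence a fraction of polynomials in \<open>F\<close>; such
  fractions are polynomials in \<open>F\<close>.  Applied to the two variables this gives a left inverse of \<open>F\<close>.
\<close>

lemma Keller_noninvertible_generic_rank:
  assumes F: "Keller F" and "\<not> pm_invertible F"
  shows "generic_rank F \<ge> 2"
proof (rule ccontr)
  assume rank: "\<not> ?thesis"
  have "\<exists>f. z = bsubst f F" for z
  proof -
    have "\<not> independent_over F 2 (\<lambda>k. if k = 0 then 1 else z)"
      using rank generic_rank_ge by blast
    then obtain p k where p: "bsubst (p 0) F + bsubst (p (Suc 0)) F * z = 0" "k < 2" "p k \<noteq> 0"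
      by (auto simp: independent_over_def numeral_2_eq_2)
    have "p (Suc 0) \<noteq> 0"
    proof
      assume "p (Suc 0) = 0"
      then have "p 0 = 0"
        using p(1) Keller_algebraically_independent[OF F] by simp
      with \<open>p (Suc 0) = 0\<close> p(2,3) show False
        by (auto simp: less_2_cases_iff)
    qed
    moreover have "bsubst (p (Suc 0)) F * z = bsubst (- p 0) F"
      using p(1) by (simp add: eq_neg_iff_add_eq_0 add.commute)
    ultimately show ?thesis
      by (rule Keller_fraction_is_polynomial[OF F])
  qed
  then obtain u v where "bsubst u F = varX" "bsubst v F = varY"
    by metis
  then have "(u, v) \<circ>\<^sub>2 F = pm_id"
    by (simp add: pm_comp_def pm_id_def)
  with F assms(2) show False
    using Keller_left_inverse_imp_invertible by blast
qed

section \<open>Generic shears restore the degree condition\<close>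

lemma degree_le_total_degree: "degree p \<le> total_degree p"
proof (cases "p = 0")
  case False
  then obtain i where "coeff (lead_coeff p) i \<noteq> 0"
    by (metis leading_coeff_0_iff)
  then show ?thesis
    using le_total_degree by fastforce
qed simp

text \<open>
  The degree condition on a polynomial of total degree \<open>n > 0\<close> says that the coefficient of \<open>Y\<^sup>n\<close>
  is nonzero.  The next lemmas give this criterion in both directions.
\<close>

lemma total_degree_eq_degreeI:
  assumes "total_degree p \<le> n" and "n = 0 \<or> coeff (coeff p n) 0 \<noteq> 0"
  shows "total_degree p = degree p"
proof -
  have "n \<le> degree p"
    using assms(2) by (auto intro: le_degree)
  with assms(1) degree_le_total_degree[of p] show ?thesis
    by linarith
qed

lemma total_degree_eq_degreeD:
  assumes "total_degree p = degree p" "degree p \<noteq> 0"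
  shows "coeff (coeff p (degree p)) 0 \<noteq> 0"
proof -
  have "lead_coeff p \<noteq> 0"
    using assms(2) by auto
  then obtain i where i: "coeff (lead_coeff p) i \<noteq> 0"
    by (metis leading_coeff_0_iff)
  then have "i = 0"
    using le_total_degree[OF i] assms(1) by simp
  with i show ?thesis by simp
qed

text \<open>
  For polynomials of total degree at most \<open>n\<close>, taking the coefficient of \<open>Y\<^sup>n\<close> means evaluating
  the homogeneous part of degree \<open>n\<close> at \<open>(0, 1)\<close>; this is why it is multiplicative.
\<close>

lemma coeff_top_mult:
  assumes p: "total_degree p \<le> m" and q: "total_degree q \<le> n"
  shows "coeff (coeff (p * q) (m + n)) 0 = coeff (coeff p m) 0 * coeff (coeff q n) 0"
proof -
  have "coeff (coeff (p * q) (m + n)) 0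
      = (\<Sum>k\<le>m + n. coeff (coeff p k) 0 * coeff (coeff q (m + n - k)) 0)"
    by (simp add: coeff_coeff_mult)
  also have "\<dots> = (\<Sum>k\<in>{m}. coeff (coeff p k) 0 * coeff (coeff q (m + n - k)) 0)"
  proof (rule sum.mono_neutral_right)
    have "coeff (coeff p k) 0 = 0 \<or> coeff (coeff q (m + n - k)) 0 = 0" if "k \<le> m + n" "k \<noteq> m" for k
      using p q that unfolding total_degree_le_iff by (cases "k < m") fastforce+
    then show "\<forall>k\<in>{..m + n} - {m}. coeff (coeff p k) 0 * coeff (coeff q (m + n - k)) 0 = 0"
      by auto
  qed auto
  finally show ?thesis by simp
qed

lemma coeff_top_power:
  assumes "total_degree p \<le> m"
  shows "coeff (coeff (p ^ k) (k * m)) 0 = coeff (coeff p m) 0 ^ k"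
proof (induction k)
  case (Suc k)
  then show ?case
    using coeff_top_mult[OF assms total_degree_power_le[OF assms, of k]] by simp
qed simp

definition shear :: "complex \<Rightarrow> polymap" where
  "shear t = (varX + bconst t * varY, varY)"

lemma shear_shear [simp]: "shear s \<circ>\<^sub>2 shear t = shear (s + t)"
  by (simp add: shear_def pm_comp_def algebra_simps flip: bconst_arith)

lemma shear_0 [simp]: "shear 0 = pm_id"
  by (simp add: shear_def pm_id_def)

lemma shear_cancel [simp]:
  "shear t \<circ>\<^sub>2 (shear (- t) \<circ>\<^sub>2 F) = F" "shear (- t) \<circ>\<^sub>2 (shear t \<circ>\<^sub>2 F) = F"
  by (simp_all flip: pm_comp_assoc)

lemma pm_invertible_shear: "pm_invertible (shear t)"
  unfolding pm_invertible_def by (rule exI[of _ "shear (- t)"]) simp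

lemma pm_invertible_shear_comp [simp]: "pm_invertible (shear t \<circ>\<^sub>2 F) \<longleftrightarrow> pm_invertible F"
  by (metis pm_invertible_comp pm_invertible_shear shear_cancel(2))

lemma pm_invertible_comp_shear [simp]: "pm_invertible (F \<circ>\<^sub>2 shear t) \<longleftrightarrow> pm_invertible F"
proof
  assume "pm_invertible (F \<circ>\<^sub>2 shear t)"
  then have "pm_invertible ((F \<circ>\<^sub>2 shear t) \<circ>\<^sub>2 shear (- t))"
    using pm_invertible_comp pm_invertible_shear by blast
  then show "pm_invertible F"
    by (simp add: pm_comp_assoc)
qed (simp add: pm_invertible_comp pm_invertible_shear)

lemma Keller_shear: "Keller (shear t)"
  by (simp add: jac_def shear_def deriv_X.D_add deriv_Y.D_add deriv_X.D_mult deriv_Y.D_mult)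

lemma shear_uminus_comp: "shear (- t) \<circ>\<^sub>2 F = (fst F - bconst t * snd F, snd F)"
  by (simp add: shear_def pm_comp_def flip: bconst_arith(4))

lemma total_degree_varY: "total_degree varY \<le> 1"
  unfolding total_degree_le_iff by (auto simp: varY_def coeff_pCons split: nat.splits)

lemma total_degree_shear: "total_degree (varX + bconst t * varY) \<le> 1"
  unfolding total_degree_le_iff
  by (auto simp: varX_def varY_def bconst_def coeff_pCons split: nat.splits)

lemma coeff_shear: "coeff (coeff (varX + bconst t * varY) 1) 0 = t" "coeff (coeff varY 1) 0 = 1"
  by (simp_all add: varX_def varY_def bconst_def)

lemma total_degree_attained:
  assumes "total_degree p \<noteq> 0"
  shows "\<exists>i j. coeff (coeff p j) i \<noteq> 0 \<and> i + j = total_degree p"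
proof -
  have "total_degree p \<in> insert 0 {i + j | i j. coeff (coeff p j) i \<noteq> 0}"
    unfolding total_degree_def using finite_support_bpoly by (intro Max_in) auto
  with assms have "total_degree p \<in> {i + j | i j. coeff (coeff p j) i \<noteq> 0}"
    by simp
  then show ?thesis
    unfolding mem_Collect_eq by metis
qed

text \<open>
  Let \<open>n > 0\<close> be the total degree of \<open>p\<close>.  The coefficient of \<open>Y\<^sup>n\<close> in \<open>p(X + t Y, Y)\<close> is the value
  at \<open>(t, 1)\<close> of the leading form of \<open>p\<close>, a nonzero polynomial \<open>q\<close> in \<open>t\<close>.
\<close>

lemma finite_shear_right_not_full:
  "finite {t. total_degree (bsubst p (shear t)) \<noteq> degree (bsubst p (shear t))}"
proof -
  define n where "n = total_degree p"
  define c where "c = (\<lambda>i j. coeff (coeff p j) i)"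
  define q where "q = (\<Sum>i\<le>n. monom (c i (n - i)) i)"
  define H where "H = (\<lambda>t i j. (varX + bconst t * varY) ^ i * varY ^ j)"
  have c: "c i j = 0" if "i + j > n" for i j
    using le_total_degree[of p j i] that unfolding c_def n_def by linarith
  have eq: "bsubst p (shear t) = (\<Sum>(i, j)\<in>{..n} \<times> {..n}. bconst (c i j) * H t i j)" for t
    by (subst bpoly_eq_sum_monomials[of p n])
      (simp_all add: n_def c_def H_def shear_def case_prod_unfold)
  have X: "total_degree ((varX + bconst t * varY) ^ i) \<le> i * 1" for t i
    by (intro total_degree_power_le total_degree_shear)
  have Y: "total_degree (varY ^ j) \<le> j * 1" for j
    by (intro total_degree_power_le total_degree_varY)
  have H: "total_degree (H t i j) \<le> i + j" for t i j
    using total_degree_mult_le[OF X Y] unfolding H_def by simp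
  have top: "coeff (coeff (H t i j) (i + j)) 0 = t ^ i" for t i j
    using coeff_top_mult[OF X Y, of t i j] unfolding H_def coeff_top_power[OF total_degree_shear]
      coeff_top_power[OF total_degree_varY] coeff_shear by simp
  have deg: "total_degree (bsubst p (shear t)) \<le> n" for t
    unfolding eq
  proof (rule total_degree_sum_le, clarify)
    fix i j
    show "total_degree (bconst (c i j) * H t i j) \<le> n"
    proof (cases "i + j \<le> n")
      case True
      have "total_degree (bconst (c i j) * H t i j) \<le> 0 + (i + j)"
        using H by (intro total_degree_mult_le) simp_all
      with True show ?thesis by simp
    next
      case False
      then show ?thesis
        using c[of i j] total_degree_bconst[of 0] by simp
    qed
  qed
  have coeff: "coeff (coeff (bsubst p (shear t)) n) 0 = poly q t" for t
  proof -
    have "coeff (coeff (bconst (c i j) * H t i j) n) 0 = (if j = n - i then c i j * t ^ i else 0)"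
      if "i \<le> n" for i j
    proof (cases "i + j = n")
      case True
      then show ?thesis
        using top[of t i j] by (auto simp: bconst_def)
    next
      case False
      have "c i j * coeff (coeff (H t i j) n) 0 = 0"
        using c[of i j] le_total_degree[of "H t i j" n 0] H[of t i j] False by force
      with False that show ?thesis
        by (auto simp: bconst_def)
    qed
    then have "coeff (coeff (bsubst p (shear t)) n) 0
        = (\<Sum>i\<le>n. \<Sum>j\<le>n. if j = n - i then c i j * t ^ i else 0)"
      unfolding eq sum.cartesian_product[symmetric] coeff_sum by (intro sum.cong refl) simp
    also have "\<dots> = poly q t"
      by (simp add: q_def poly_sum poly_monom)
    finally show ?thesis .
  qed
  show ?thesis
  proof (cases "n = 0")
    case True
    then show ?thesis
      using total_degree_eq_degreeI[OF deg] by simp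
  next
    case False
    then obtain i j where ij: "c i j \<noteq> 0" "i + j = n"
      using total_degree_attained[of p] unfolding n_def c_def by blast
    have "coeff q i = c i (n - i)"
      using ij by (simp add: q_def coeff_sum sum.delta)
    with ij have "q \<noteq> 0"
      by auto
    then have "finite {t. poly q t = 0}"
      by (rule poly_roots_finite)
    moreover have "{t. total_degree (bsubst p (shear t)) \<noteq> degree (bsubst p (shear t))}
        \<subseteq> {t. poly q t = 0}"
      using total_degree_eq_degreeI[OF deg] coeff by auto
    ultimately show ?thesis
      by (rule rev_finite_subset)
  qed
qed

text \<open>
  At the larger of the two degrees, \<open>n > 0\<close>, the coefficients \<open>a\<close> and \<open>b\<close> of \<open>Y\<^sup>n\<close> in \<open>p\<close> and
  \<open>q\<close> are not both zero, and only \<open>t\<close> with \<open>a = t b\<close> is exceptional.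
\<close>

lemma finite_shear_left_not_full:
  assumes p: "total_degree p = degree p" and q: "total_degree q = degree q"
  shows "finite {t. total_degree (p - bconst t * q) \<noteq> degree (p - bconst t * q)}"
proof -
  define n where "n = max (degree p) (degree q)"
  define a b where "a = coeff (coeff p n) 0" and "b = coeff (coeff q n) 0"
  have deg: "total_degree (p - bconst t * q) \<le> n" for t
  proof -
    have pq: "total_degree p \<le> n" "total_degree q \<le> n"
      using p q by (simp_all add: n_def)
    show ?thesis
      unfolding total_degree_le_iff
    proof (intro allI impI)
      fix i j
      assume "coeff (coeff (p - bconst t * q) j) i \<noteq> 0"
      then have "coeff (coeff p j) i \<noteq> 0 \<or> coeff (coeff q j) i \<noteq> 0"
        by (auto simp: bconst_def)
      with pq show "i + j \<le> n"
        unfolding total_degree_le_iff by blast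
    qed
  qed
  show ?thesis
  proof (cases "n = 0")
    case True
    then show ?thesis
      using total_degree_eq_degreeI[OF deg] by simp
  next
    case False
    then have "a \<noteq> 0 \<or> b \<noteq> 0"
      using total_degree_eq_degreeD[OF p] total_degree_eq_degreeD[OF q]
      unfolding a_def b_def n_def by (auto simp: max_def split: if_splits)
    have "{t. total_degree (p - bconst t * q) \<noteq> degree (p - bconst t * q)} \<subseteq> {a / b}"
    proof clarify
      fix t assume "total_degree (p - bconst t * q) \<noteq> degree (p - bconst t * q)"
      then have "coeff (coeff (p - bconst t * q) n) 0 = 0"
        using total_degree_eq_degreeI[OF deg] by blast
      then have "a = t * b"
        by (simp add: a_def b_def bconst_def)
      with \<open>a \<noteq> 0 \<or> b \<noteq> 0\<close> show "t = a / b"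
        by auto
    qed
    then show ?thesis
      by (rule finite_subset) simp
  qed
qed

lemma et_iff:
  "F \<in> et \<longleftrightarrow> Keller F \<and> total_degree (fst F) = degree (fst F) \<and> total_degree (snd F) = degree (snd F)"
  by (simp add: et_def det_jacobian)

lemma mem_et_minus_Aut: "F \<in> et - Aut \<longleftrightarrow> F \<in> et \<and> \<not> pm_invertible F"
  by (auto simp: Aut_def)

lemma finite_comp_shear_not_et:
  assumes "Keller G"
  shows "finite {t. G \<circ>\<^sub>2 shear t \<notin> et}"
proof -
  have "{t. G \<circ>\<^sub>2 shear t \<notin> et} \<subseteq>
      {t. total_degree (bsubst (fst G) (shear t)) \<noteq> degree (bsubst (fst G) (shear t))} \<union>
      {t. total_degree (bsubst (snd G) (shear t)) \<noteq> degree (bsubst (snd G) (shear t))}"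
    using Keller_comp[OF assms Keller_shear] unfolding et_iff by (auto simp: pm_comp_def)
  then show ?thesis
    by (rule finite_subset) (simp add: finite_shear_right_not_full)
qed

lemma finite_shear_comp_not_et:
  assumes "H \<in> et"
  shows "finite {t. shear (- t) \<circ>\<^sub>2 H \<notin> et}"
proof (rule finite_subset)
  have "Keller (shear t \<circ>\<^sub>2 H)" for t
    using assms by (simp add: Keller_comp[OF Keller_shear] et_iff)
  from this[of "- t" for t] show "{t. shear (- t) \<circ>\<^sub>2 H \<notin> et} \<subseteq>
      {t. total_degree (fst H - bconst t * snd H) \<noteq> degree (fst H - bconst t * snd H)}"
    using assms unfolding et_iff shear_uminus_comp by auto
  show "finite {t. total_degree (fst H - bconst t * snd H) \<noteq> degree (fst H - bconst t * snd H)}"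
    using assms by (intro finite_shear_left_not_full) (auto simp: et_iff)
qed

lemma shear_mem_Aut:
  assumes "t \<noteq> 0"
  shows "shear t \<in> Aut"
proof -
  have "total_degree (fst (shear t)) = degree (fst (shear t))"
    unfolding shear_def fst_conv
    by (rule total_degree_eq_degreeI[OF total_degree_shear]) (simp only: coeff_shear assms not_False_eq_True simp_thms)
  moreover have "total_degree (snd (shear t)) = degree (snd (shear t))"
    unfolding shear_def snd_conv
    by (rule total_degree_eq_degreeI[OF total_degree_varY]) (simp only: coeff_shear one_neq_zero simp_thms)
  ultimately show ?thesis
    unfolding Aut_def et_iff using Keller_shear pm_invertible_shear by blast
qed

text \<open>
  A shear and its inverse can be inserted between \<open>G\<close> and \<open>H\<close> without changing their
  composition.  For generic \<open>t\<close> this makes \<open>G\<close>, which may violate the degree condition, an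
  element of \<open>et\<close>, and it keeps \<open>H\<close> in \<open>et\<close>.
\<close>

lemma ex_shear_regularizing:
  assumes "Keller G" "H \<in> et"
  shows "\<exists>t. G \<circ>\<^sub>2 shear t \<in> et \<and> shear (- t) \<circ>\<^sub>2 H \<in> et"
proof -
  have "finite ({t. G \<circ>\<^sub>2 shear t \<notin> et} \<union> {t. shear (- t) \<circ>\<^sub>2 H \<notin> et})"
    using assms by (simp add: finite_comp_shear_not_et finite_shear_comp_not_et)
  then obtain t where "t \<notin> {t. G \<circ>\<^sub>2 shear t \<notin> et} \<union> {t. shear (- t) \<circ>\<^sub>2 H \<notin> et}"
    using ex_new_if_finite[OF infinite_UNIV_char_0] by blast
  then show ?thesis
    by blast
qed

section \<open>Prime factorizations\<close>

text \<open>
  From a decomposition of \<open>shear t \<circ> P\<close> one gets a decomposition of \<open>P\<close> by moving the shear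
  to the left factor, which is then brought back into \<open>et\<close> by a second, generic shear.
\<close>

lemma prime_shear_comp:
  assumes P: "P \<in> et_p" and t: "shear t \<circ>\<^sub>2 P \<in> et"
  shows "shear t \<circ>\<^sub>2 P \<in> et_p"
proof -
  have P': "P \<in> et" "\<not> pm_invertible P" "\<not> composite P"
    using P by (auto simp: et_p_def Aut_def)
  have "\<not> composite (shear t \<circ>\<^sub>2 P)"
  proof
    assume "composite (shear t \<circ>\<^sub>2 P)"
    then obtain G H where G: "G \<in> et" "\<not> pm_invertible G" and H: "H \<in> et" "\<not> pm_invertible H"
      and eq: "shear t \<circ>\<^sub>2 P = G \<circ>\<^sub>2 H"
      unfolding composite_def Bex_def mem_et_minus_Aut by blast
    have "Keller (shear (- t) \<circ>\<^sub>2 G)"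
      using G(1) by (simp add: Keller_comp Keller_shear et_iff)
    then obtain s where s: "(shear (- t) \<circ>\<^sub>2 G) \<circ>\<^sub>2 shear s \<in> et" "shear (- s) \<circ>\<^sub>2 H \<in> et"
      using ex_shear_regularizing H(1) by blast
    have "P = shear (- t) \<circ>\<^sub>2 (G \<circ>\<^sub>2 H)"
      by (simp flip: eq)
    also have "\<dots> = ((shear (- t) \<circ>\<^sub>2 G) \<circ>\<^sub>2 shear s) \<circ>\<^sub>2 (shear (- s) \<circ>\<^sub>2 H)"
      by (simp add: pm_comp_assoc)
    finally have "composite P"
      unfolding composite_def Bex_def mem_et_minus_Aut
      using s G(2) H(2) P'(1) by (metis pm_invertible_shear_comp pm_invertible_comp_shear)
    with P' show False by simp
  qed
  with t P' show ?thesis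
    by (simp add: et_p_def Aut_def)
qed

text \<open>
  The generic rank is supermultiplicative, at least 1 on Keller maps and at least 2 on those
  without inverse.
\<close>

lemma generic_rank_less_comp:
  assumes "Keller G" "Keller H"
  shows "\<not> pm_invertible H \<Longrightarrow> generic_rank G < generic_rank (G \<circ>\<^sub>2 H)"
    and "\<not> pm_invertible G \<Longrightarrow> generic_rank H < generic_rank (G \<circ>\<^sub>2 H)"
proof -
  note pos = Keller_generic_rank_pos[OF assms(1)] Keller_generic_rank_pos[OF assms(2)]
  show "generic_rank G < generic_rank (G \<circ>\<^sub>2 H)" if "\<not> pm_invertible H"
  proof -
    have "generic_rank G * 2 \<le> generic_rank (G \<circ>\<^sub>2 H)"
      using Keller_noninvertible_generic_rank[OF assms(2) that] generic_rank_comp[of G H]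
      by (meson le_trans mult_le_mono2)
    with pos show ?thesis by linarith
  qed
  show "generic_rank H < generic_rank (G \<circ>\<^sub>2 H)" if "\<not> pm_invertible G"
  proof -
    have "2 * generic_rank H \<le> generic_rank (G \<circ>\<^sub>2 H)"
      using Keller_noninvertible_generic_rank[OF assms(1) that] generic_rank_comp[of G H]
      by (meson le_trans mult_le_mono1)
    with pos show ?thesis by linarith
  qed
qed

text \<open>
  A prime \<open>F\<close> cannot be written as \<open>pm_id \<circ> F\<close>, as \<open>pm_id\<close> violates the degree condition; a
  nontrivial shear takes the place of \<open>pm_id\<close>.  If \<open>F = G \<circ> H\<close> is composite, a prime right factor
  \<open>P\<close> of \<open>H\<close>, which has smaller rank, is up to a shear a right factor of \<open>F\<close>.
\<close>

lemma ex_prime_right_factor: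
  assumes "F \<in> et" "\<not> pm_invertible F"
  shows "\<exists>G P. G \<in> et \<and> P \<in> et_p \<and> F = G \<circ>\<^sub>2 P"
  using assms
proof (induction "generic_rank F" arbitrary: F rule: less_induct)
  case (less F)
  show ?case
  proof (cases "composite F")
    case False
    then have F: "F \<in> et_p"
      using less.prems by (simp add: et_p_def Aut_def)
    have "finite (insert 0 {t. shear (- t) \<circ>\<^sub>2 F \<notin> et})"
      using finite_shear_comp_not_et[OF less.prems(1)] by simp
    then obtain t where "t \<notin> insert 0 {t. shear (- t) \<circ>\<^sub>2 F \<notin> et}"
      using ex_new_if_finite[OF infinite_UNIV_char_0] by blast
    then have t: "t \<noteq> 0" "shear (- t) \<circ>\<^sub>2 F \<in> et"
      by blast+
    have "F = shear t \<circ>\<^sub>2 (shear (- t) \<circ>\<^sub>2 F)"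
      by simp
    moreover have "shear t \<in> et"
      using shear_mem_Aut[OF t(1)] by (simp add: Aut_def)
    ultimately show ?thesis
      using prime_shear_comp[OF F t(2)] by blast
  next
    case True
    then obtain G H where G: "G \<in> et" "\<not> pm_invertible G" and H: "H \<in> et" "\<not> pm_invertible H"
      and F: "F = G \<circ>\<^sub>2 H"
      unfolding composite_def Bex_def mem_et_minus_Aut by blast
    have K: "Keller G" "Keller H"
      using G H by (simp_all add: et_iff)
    have "generic_rank H < generic_rank F"
      unfolding F by (rule generic_rank_less_comp(2)[OF K G(2)])
    then obtain H' P where H': "H' \<in> et" "P \<in> et_p" "H = H' \<circ>\<^sub>2 P"
      using less.hyps H by blast
    then have P: "P \<in> et"
      by (simp add: et_p_def)
    have "Keller (G \<circ>\<^sub>2 H')"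
      using K H'(1) by (simp add: Keller_comp et_iff)
    then obtain t where t: "(G \<circ>\<^sub>2 H') \<circ>\<^sub>2 shear t \<in> et" "shear (- t) \<circ>\<^sub>2 P \<in> et"
      using ex_shear_regularizing P by blast
    have "F = ((G \<circ>\<^sub>2 H') \<circ>\<^sub>2 shear t) \<circ>\<^sub>2 (shear (- t) \<circ>\<^sub>2 P)"
      by (simp add: F H'(3) pm_comp_assoc)
    then show ?thesis
      using t prime_shear_comp[OF H'(2) t(2)] by blast
  qed
qed

lemma ex_prime_factorization:
  assumes "F \<in> et"
  shows "\<exists>A\<^sub>0 Ps. A\<^sub>0 \<in> Aut \<and> set Ps \<subseteq> et_p \<and> F = foldl (\<circ>\<^sub>2) A\<^sub>0 Ps"
  using assms
proof (induction "generic_rank F" arbitrary: F rule: less_induct)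
  case (less F)
  show ?case
  proof (cases "pm_invertible F")
    case True
    then have "F \<in> Aut \<and> set [] \<subseteq> et_p \<and> F = foldl (\<circ>\<^sub>2) F []"
      using less.prems by (simp add: Aut_def)
    then show ?thesis by blast
  next
    case False
    then obtain G P where GP: "G \<in> et" "P \<in> et_p" "F = G \<circ>\<^sub>2 P"
      using ex_prime_right_factor less.prems by blast
    then have "Keller G" "Keller P" "\<not> pm_invertible P"
      by (auto simp: et_iff et_p_def Aut_def)
    then have "generic_rank G < generic_rank F"
      unfolding GP(3) by (rule generic_rank_less_comp(1))
    then obtain A Ps where "A \<in> Aut" "set Ps \<subseteq> et_p" "G = foldl (\<circ>\<^sub>2) A Ps"
      using less.hyps GP(1) by blast
    then have "A \<in> Aut \<and> set (Ps @ [P]) \<subseteq> et_p \<and> F = foldl (\<circ>\<^sub>2) A (Ps @ [P])"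
      using GP by simp
    then show ?thesis by blast
  qed
qed

theorem theorem4p5:
  assumes "et \<noteq> Aut"
  shows "et_p \<noteq> {}
    \<and> (\<forall>F \<in> et. \<exists>(k::nat) A\<^sub>0 Ps. A\<^sub>0 \<in> Aut \<and> length Ps = k \<and> set Ps \<subseteq> et_p
          \<and> F = foldl (\<circ>\<^sub>2) A\<^sub>0 Ps)"
proof
  obtain F where "F \<in> et" "\<not> pm_invertible F"
    using assms by (auto simp: Aut_def)
  then show "et_p \<noteq> {}"
    using ex_prime_right_factor by blast
  show "\<forall>F \<in> et. \<exists>(k::nat) A\<^sub>0 Ps. A\<^sub>0 \<in> Aut \<and> length Ps = k \<and> set Ps \<subseteq> et_p
          \<and> F = foldl (\<circ>\<^sub>2) A\<^sub>0 Ps"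
    using ex_prime_factorization by blast
qed

end
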